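(* Let $m\ge2$, let $H_k(x):=\sum_{j=k}^{m-1}G_j(x)$ for $k=0,1,\dots,m-1$, and let $\Phi_x(u):=u+\frac{x}{1-u}$ for formal power series $u$ in $x$ with zero constant term. Then for each $k=0,1,\dots,m-2$, $$H_k(x)=\Phi_x\bigl(H_{k+1}(x)\bigr).$$ In particular, writing $U(x):=H_{m-1}(x)=G_{m-1}(x)$, $$G(x)=\Phi_x^{\,m-1}\bigl(U(x)\bigr),$$ where $\Phi_x^{\,m-1}$ denotes the $(m-1)$-fold iterate.
   Context: For an integer $m\ge2$ let $V_m=\{v_0<v_1<\cdots<v_{m-1}\}$ ($v_0=0$, $v_{m-1}=1$) be an $m$-element chain with Gödel implication $v_p\Rightarrow_G v_q=v_{m-1}$ if $p\le q$ and $v_p\Rightarrow_G v_q=v_q$ if $p>q$. For $n\ge1$, consider the $C_{n-1}$ full bracketings of $p_1\Rightarrow_G\cdots\Rightarrow_G p_n$ in $n$ distinct variables (full binary trees with $n$ ordered leaves), $C_k$ being the Catalan numbers. Let $g_n^{(j)}$ be the number of pairs (bracketing, valuation $\{p_1,\dots,p_n\}\to V_m$) for which the bracketed formula evaluates to $v_j$, and $g_n=\sum_{j=0}^{m-1}g_n^{(j)}=m^nC_{n-1}$. Put $G_j(x)=\sum_{n\ge1}g_n^{(j)}x^n$ and $G(x)=\sum_{n\ge1}g_nx^n=\sum_{j=0}^{m-1}G_j(x)$ (formal power series). *)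

theory Defs
  imports
    "HOL-Library.FuncSet"
    "HOL-Computational_Algebra.Formal_Power_Series"
begin

datatype imp_form = Var nat | Imp imp_form imp_form

primrec leaves :: "imp_form \<Rightarrow> nat list" where
  "leaves (Var i) = [i]"
| "leaves (Imp a b) = leaves a @ leaves b"

text \<open>A full bracketing of \<open>p\<^sub>1 \<Rightarrow> \<dots> \<Rightarrow> p\<^sub>n\<close> is an implicational formula whose variables, read
  from left to right, are exactly \<open>p\<^sub>1, \<dots>, p\<^sub>n\<close>.\<close>

definition bracketings :: "nat \<Rightarrow> imp_form set" where
  "bracketings n = {\<phi>. leaves \<phi> = [1..<Suc n]}"

text \<open>The truth values form a chain with greatest element \<open>1\<close>. For a strictly increasing
  enumeration \<open>v\<close> of it, \<open>v p \<le> v q\<close> holds if and only if \<open>p \<le> q\<close>.\<close>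

definition godel_imp :: "'a::{linorder,one} \<Rightarrow> 'a \<Rightarrow> 'a" where
  "godel_imp a b = (if a \<le> b then 1 else b)"

primrec eval_form :: "(nat \<Rightarrow> 'a::{linorder,one}) \<Rightarrow> imp_form \<Rightarrow> 'a" where
  "eval_form \<rho> (Var i) = \<rho> i"
| "eval_form \<rho> (Imp a b) = godel_imp (eval_form \<rho> a) (eval_form \<rho> b)"

text \<open>Valuations are extensional functions on \<open>{1..n}\<close>, so that each map from the \<open>n\<close> variables
  to the \<open>m\<close>-element chain is counted once.\<close>

definition valuations :: "nat \<Rightarrow> (nat \<Rightarrow> 'a) \<Rightarrow> nat \<Rightarrow> (nat \<Rightarrow> 'a) set" where
  "valuations m v n = {1..n} \<rightarrow>\<^sub>E v ` {..<m}"

definition g_val :: "nat \<Rightarrow> (nat \<Rightarrow> 'a::{linorder,one}) \<Rightarrow> nat \<Rightarrow> nat \<Rightarrow> nat" where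
  "g_val m v j n =
     card {(\<phi>, \<rho>). \<phi> \<in> bracketings n \<and> \<rho> \<in> valuations m v n \<and> eval_form \<rho> \<phi> = v j}"

definition g_total :: "nat \<Rightarrow> (nat \<Rightarrow> 'a::{linorder,one}) \<Rightarrow> nat \<Rightarrow> nat" where
  "g_total m v n = (\<Sum>j=0..m-1. g_val m v j n)"

text \<open>Rational coefficients make the quotient in \<open>Phi\<close> available; all series \<open>G_val\<close>, \<open>G_total\<close>
  have natural number coefficients.\<close>

definition G_val :: "nat \<Rightarrow> (nat \<Rightarrow> 'a::{linorder,one}) \<Rightarrow> nat \<Rightarrow> rat fps" where
  "G_val m v j = Abs_fps (\<lambda>n. if n \<ge> 1 then of_nat (g_val m v j n) else 0)"

definition G_total :: "nat \<Rightarrow> (nat \<Rightarrow> 'a::{linorder,one}) \<Rightarrow> rat fps" where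
  "G_total m v = Abs_fps (\<lambda>n. if n \<ge> 1 then of_nat (g_total m v n) else 0)"

definition H_ser :: "nat \<Rightarrow> (nat \<Rightarrow> 'a::{linorder,one}) \<Rightarrow> nat \<Rightarrow> rat fps" where
  "H_ser m v k = (\<Sum>j=k..m-1. G_val m v j)"

text \<open>\<open>Phi\<close> is meant for series with zero constant term, where \<open>1 - u\<close> is a unit and the division
  is multiplication by its inverse; such series are mapped to such series.\<close>

definition Phi :: "rat fps \<Rightarrow> rat fps" where
  "Phi u = u + fps_X / (1 - u)"

lemma Phi_unit: "fps_nth u 0 = 0 \<Longrightarrow> Phi u = u + fps_X * inverse (1 - u)"
  by (simp add: Phi_def fps_divide_unit)

lemma Phi_nth_0: "fps_nth u 0 = 0 \<Longrightarrow> fps_nth (Phi u) 0 = 0"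
  by (simp add: Phi_unit)

lemma H_ser_nth_0: "fps_nth (H_ser m v k) 0 = 0"
  by (simp add: H_ser_def G_val_def fps_sum_nth)

lemma leaves_not_Nil [simp]: "leaves \<phi> \<noteq> []"
  by (induction \<phi>) auto

lemma finite_leaves: "finite {\<phi>. leaves \<phi> = xs}"
proof (induction xs rule: length_induct)
  case (1 xs)
  let ?F = "\<lambda>ys. {\<phi>. leaves \<phi> = ys}"
  let ?I = "{i. 0 < i \<and> i < length xs}"
  have "?F xs \<subseteq> Var ` set xs \<union> (\<Union>i\<in>?I. case_prod Imp ` (?F (take i xs) \<times> ?F (drop i xs)))"
  proof
    fix \<phi> assume "\<phi> \<in> ?F xs"
    then have \<phi>: "leaves \<phi> = xs" by simp
    show "\<phi> \<in> Var ` set xs \<union> (\<Union>i\<in>?I. case_prod Imp ` (?F (take i xs) \<times> ?F (drop i xs)))"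
    proof (cases \<phi>)
      case (Var i)
      then show ?thesis using \<phi> by auto
    next
      case (Imp a b)
      let ?i = "length (leaves a)"
      have "?i \<in> ?I" "leaves a = take ?i xs" "leaves b = drop ?i xs"
        using \<phi> Imp by auto
      then show ?thesis using Imp by (intro UnI2 UN_I[of ?i]) (auto intro!: image_eqI[of _ _ "(a, b)"])
    qed
  qed
  moreover have "finite (\<Union>i\<in>?I. case_prod Imp ` (?F (take i xs) \<times> ?F (drop i xs)))"
    using 1 by (intro finite_UN_I finite_imageI finite_cartesian_product) auto
  ultimately show ?case
    by (meson finite_Un finite_imageI finite_set finite_subset)
qed

lemma finite_bracketings: "finite (bracketings n)"
  unfolding bracketings_def by (rule finite_leaves)

lemma finite_valuations: "finite (valuations m v n)"
  unfolding valuations_def by (intro finite_PiE) auto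

end

theory Submission
  imports Defs
begin

text \<open>For \<open>j < m - 1\<close> an implication \<open>a \<Rightarrow> b\<close> takes the non-top value \<open>v j\<close> exactly when \<open>b\<close> does and
  \<open>a\<close> is strictly larger. Splitting a bracketing at its root therefore gives
  \<open>G_val j = X + H_ser (j + 1) * G_val j\<close>, that is, \<open>G_val j = X / (1 - H_ser (j + 1))\<close>; adding
  \<open>H_ser (j + 1)\<close> yields the recursion. To split at the root without renumbering variables, a pair
  of a bracketing and a valuation is encoded as one formula whose leaf labels are the indices of the
  truth values.\<close>

section \<open>Relabelling the leaves of a formula\<close>

primrec relabel :: "(nat \<Rightarrow> nat) \<Rightarrow> imp_form \<Rightarrow> imp_form" where
  "relabel f (Var i) = Var (f i)"
| "relabel f (Imp a b) = Imp (relabel f a) (relabel f b)"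

lemma leaves_relabel: "leaves (relabel f \<phi>) = map f (leaves \<phi>)"
  by (induction \<phi>) auto

lemma relabel_eq_iff: "relabel f \<phi> = relabel f' \<phi> \<longleftrightarrow> (\<forall>i\<in>set (leaves \<phi>). f i = f' i)"
  by (induction \<phi>) auto

text \<open>Relabelling preserves the tree shape, and shape and leaf word together determine a
  formula. This lets a bracketing be recovered from its encoding.\<close>

lemma relabel_inject_leaves:
  assumes "relabel f \<phi> = relabel f' \<psi>" and "leaves \<phi> = leaves \<psi>"
  shows "\<phi> = \<psi>"
  using assms
proof (induction \<phi> arbitrary: \<psi>)
  case (Var i)
  then show ?case by (cases \<psi>) auto
next
  case (Imp a b)
  then obtain c d where \<psi>: "\<psi> = Imp c d" by (cases \<psi>) auto
  then have "relabel f a = relabel f' c" "relabel f b = relabel f' d"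
    using Imp.prems by auto
  \<comment> \<open>Equal lengths of the left leaf words split the equation between concatenations
    into \<open>leaves a = leaves c\<close> and \<open>leaves b = leaves d\<close>.\<close>
  moreover from this(1) have "length (leaves a) = length (leaves c)"
    by (metis leaves_relabel length_map)
  ultimately show ?case using Imp \<psi> by auto
qed

text \<open>Gives surjectivity of the encoding. Distinct labels keep the two subtrees from sharing a
  variable, so their separately built labellings can be glued.\<close>

lemma exists_relabel:
  assumes "distinct xs" and "length xs = length (leaves t)"
  shows "\<exists>\<phi> f. leaves \<phi> = xs \<and> relabel f \<phi> = t"
  using assms
proof (induction t arbitrary: xs)
  case (Var i)
  then obtain x where "xs = [x]" by (auto simp: length_Suc_conv)
  then show ?case by (intro exI[of _ "Var x"] exI[of _ "\<lambda>_. i"]) simp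
next
  case (Imp a b)
  define ys zs where "ys = take (length (leaves a)) xs" and "zs = drop (length (leaves a)) xs"
  have xs: "xs = ys @ zs" by (simp add: ys_def zs_def)
  have "length ys = length (leaves a)" "length zs = length (leaves b)"
    using Imp.prems by (auto simp: ys_def zs_def)
  moreover have "distinct ys" "distinct zs"
    using Imp.prems(1) by (auto simp: xs)
  ultimately obtain \<phi> f \<psi> g where *: "leaves \<phi> = ys" "relabel f \<phi> = a" "leaves \<psi> = zs" "relabel g \<psi> = b"
    using Imp.IH(1)[of ys] Imp.IH(2)[of zs] by blast
  let ?h = "\<lambda>i. if i \<in> set ys then f i else g i"
  have "relabel ?h \<phi> = relabel f \<phi>" "relabel ?h \<psi> = relabel g \<psi>"
    using * Imp.prems(1) xs by (auto simp: relabel_eq_iff)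
  then show ?case using * xs by (intro exI[of _ "Imp \<phi> \<psi>"] exI[of _ ?h]) simp
qed

lemma eval_form_relabel: "eval_form v (relabel f \<phi>) = eval_form (v \<circ> f) \<phi>"
  by (induction \<phi>) auto

lemma eval_form_cong:
  assumes "\<And>i. i \<in> set (leaves \<phi>) \<Longrightarrow> \<rho> i = \<sigma> i"
  shows "eval_form \<rho> \<phi> = eval_form \<sigma> \<phi>"
  using assms by (induction \<phi>) auto

section \<open>Formulas labelled by truth value indices\<close>

definition labelled :: "nat \<Rightarrow> nat \<Rightarrow> imp_form set" where
  "labelled m n = {t. length (leaves t) = n \<and> set (leaves t) \<subseteq> {..<m}}"

lemma labelled_0: "labelled m 0 = {}"
  by (auto simp: labelled_def)

lemma labelled_1: "labelled m 1 = Var ` {..<m}"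
proof -
  have "t \<in> range Var" if "length (leaves t) = 1" for t
  proof (cases t)
    case (Imp a b)
    have "0 < length (leaves a)" "0 < length (leaves b)" by auto
    then show ?thesis using that Imp by (auto simp del: length_greater_0_conv)
  qed auto
  then show ?thesis by (fastforce simp: labelled_def)
qed

lemma finite_labelled: "finite (labelled m n)"
proof (rule finite_subset)
  show "labelled m n \<subseteq> (\<Union>xs\<in>{xs. set xs \<subseteq> {..<m} \<and> length xs = n}. {t. leaves t = xs})"
    by (auto simp: labelled_def)
  show "finite \<dots>"
    by (intro finite_UN_I finite_lists_length_eq finite_leaves) simp
qed

text \<open>With at least two leaves the root is an implication, and \<open>i\<close> counts the
  leaves on its left. The cases \<open>i = 0\<close> and \<open>i = n\<close> contribute nothing, as
  no formula has zero leaves; with them the index range is that of a Cauchy product.\<close>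

lemma labelled_split:
  assumes "n \<ge> 2"
  shows "labelled m n = (\<Union>i\<in>{0..n}. case_prod Imp ` (labelled m i \<times> labelled m (n - i)))"
proof (intro subset_antisym subsetI)
  fix t assume t: "t \<in> labelled m n"
  then obtain a b where "t = Imp a b"
    using assms by (cases t) (auto simp: labelled_def)
  then show "t \<in> (\<Union>i\<in>{0..n}. case_prod Imp ` (labelled m i \<times> labelled m (n - i)))"
    using t by (intro UN_I[of "length (leaves a)"] image_eqI[of _ _ "(a, b)"])
      (auto simp: labelled_def)
qed (auto simp: labelled_def)

section \<open>Counting formulas by their truth value\<close>

locale godel_chain =
  fixes m :: nat and v :: "nat \<Rightarrow> 'a::{linorder,one}"
  assumes m: "m \<ge> 2"
    and mono: "strict_mono_on {..<m} v"
    and top: "v (m - 1) = 1"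
begin

lemma inj_v: "inj_on v {..<m}"
  using mono by (rule strict_mono_on_imp_inj_on)

lemma v_less_iff: "i < m \<Longrightarrow> j < m \<Longrightarrow> v i < v j \<longleftrightarrow> i < j"
  using mono by (intro strict_mono_on_less) auto

definition level :: "nat \<Rightarrow> nat \<Rightarrow> imp_form set" where
  "level j n = {t \<in> labelled m n. eval_form v t = v j}"

lemma finite_level: "finite (level j n)"
  by (simp add: level_def finite_labelled)

text \<open>The map \<open>F\<close> replaces each variable \<open>i\<close> of the bracketing by
  the index of \<open>\<rho> i\<close>; it preserves the truth value and is a bijection onto
  \<open>level j n\<close>.\<close>

lemma g_val_eq_card_level: "g_val m v j n = card (level j n)"
proof -
  let ?S = "{(\<phi>, \<rho>). \<phi> \<in> bracketings n \<and> \<rho> \<in> valuations m v n \<and> eval_form \<rho> \<phi> = v j}"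
  define h where "h = inv_into {..<m} v"
  define F where "F = (\<lambda>(\<phi>, \<rho>). relabel (h \<circ> \<rho>) \<phi>)"
  have h: "h y < m" "v (h y) = y" if "y \<in> v ` {..<m}" for y
    using that inv_into_into[of y v "{..<m}"] by (auto simp: h_def f_inv_into_f)
  have hv: "h (v i) = i" if "i < m" for i
    using that inj_v by (simp add: h_def)
  have set: "set (leaves \<phi>) = {1..n}" "length (leaves \<phi>) = n" if "\<phi> \<in> bracketings n" for \<phi>
    using that by (auto simp: bracketings_def)
  have val: "\<rho> i \<in> v ` {..<m}" if "\<rho> \<in> valuations m v n" "i \<in> {1..n}" for \<rho> i
    using that unfolding valuations_def by (rule PiE_mem)
  have "inj_on F ?S"
  proof (rule inj_onI, clarify)
    fix \<phi> \<rho> \<psi> \<sigma>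
    assume F: "F (\<phi>, \<rho>) = F (\<psi>, \<sigma>)"
      and S: "\<phi> \<in> bracketings n" "\<psi> \<in> bracketings n"
        "\<rho> \<in> valuations m v n" "\<sigma> \<in> valuations m v n"
    then have eq: "\<phi> = \<psi>"
      using relabel_inject_leaves[of "h \<circ> \<rho>" \<phi> "h \<circ> \<sigma>" \<psi>] by (simp add: F_def bracketings_def)
    have "\<rho> i = \<sigma> i" if "i \<in> {1..n}" for i
      using F eq S that h(2)[OF val] set
      by (metis F_def case_prod_conv comp_apply relabel_eq_iff)
    then have "\<rho> = \<sigma>"
      using S unfolding valuations_def by (intro PiE_ext)
    with eq show "\<phi> = \<psi> \<and> \<rho> = \<sigma>" by simp
  qed
  moreover have "F ` ?S = level j n"
  proof (intro subset_antisym subsetI)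
    fix t assume "t \<in> F ` ?S"
    then obtain \<phi> \<rho> where t: "t = relabel (h \<circ> \<rho>) \<phi>"
      and S: "\<phi> \<in> bracketings n" "\<rho> \<in> valuations m v n" "eval_form \<rho> \<phi> = v j"
      by (auto simp: F_def)
    have "eval_form v t = eval_form \<rho> \<phi>"
      unfolding t eval_form_relabel
      by (rule eval_form_cong) (use S set h(2) val in auto)
    then show "t \<in> level j n"
      using S set h(1) val by (auto simp: level_def labelled_def t leaves_relabel)
  next
    fix t assume t: "t \<in> level j n"
    from t obtain \<phi> f where \<phi>: "leaves \<phi> = [1..<Suc n]" "relabel f \<phi> = t"
      using exists_relabel[of "[1..<Suc n]" t] by (auto simp: level_def labelled_def simp del: upt_Suc)
    then have b: "\<phi> \<in> bracketings n" by (simp add: bracketings_def)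
    have f: "f i < m" if "i \<in> {1..n}" for i
    proof -
      have "f ` {1..n} \<subseteq> {..<m}"
        using t unfolding \<phi>(2)[symmetric] level_def labelled_def
        by (simp add: leaves_relabel set(1)[OF b])
      then show ?thesis using that by blast
    qed
    \<comment> \<open>The restriction makes the valuation extensional, as membership in
      \<open>valuations\<close> demands.\<close>
    let ?\<rho> = "restrict (v \<circ> f) {1..n}"
    have "eval_form ?\<rho> \<phi> = eval_form v t"
      unfolding \<phi>(2)[symmetric] eval_form_relabel
      by (rule eval_form_cong) (use set(1)[OF b] in auto)
    moreover have "relabel (h \<circ> ?\<rho>) \<phi> = t"
      unfolding \<phi>(2)[symmetric] relabel_eq_iff using set(1)[OF b] f hv by simp
    moreover have "?\<rho> \<in> valuations m v n"
      using f by (auto simp: valuations_def)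
    ultimately show "t \<in> F ` ?S"
      using b t by (intro image_eqI[of _ _ "(\<phi>, ?\<rho>)"]) (auto simp: F_def level_def)
  qed
  ultimately show ?thesis
    unfolding g_val_def using card_image[of F ?S] by simp
qed

lemma eval_in_chain:
  assumes "set (leaves t) \<subseteq> {..<m}"
  shows "eval_form v t \<in> v ` {..<m}"
proof -
  \<comment> \<open>\<open>godel_imp\<close> returns 1 or its right argument, so only 1 has to be
    checked for closure.\<close>
  have "1 \<in> v ` {..<m}" using top m by (intro image_eqI[of _ _ "m - 1"]) auto
  then show ?thesis using assms by (induction t) (auto simp: godel_imp_def)
qed

text \<open>Every value lies in the chain, so a value above \<open>v j\<close> is \<open>v l\<close>
  for exactly one \<open>l\<close> with \<open>j < l\<close>. The sum is the coefficient of
  \<open>H_ser m v (Suc j)\<close> at \<open>n\<close>.\<close>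

lemma card_above:
  assumes "j < m"
  shows "card {t \<in> labelled m n. v j < eval_form v t} = (\<Sum>l=Suc j..m-1. card (level l n))"
proof -
  have "{t \<in> labelled m n. v j < eval_form v t} = (\<Union>l\<in>{Suc j..m-1}. level l n)"
  proof (intro subset_antisym subsetI)
    fix t assume t: "t \<in> {t \<in> labelled m n. v j < eval_form v t}"
    then obtain l where "l < m" "eval_form v t = v l"
      using eval_in_chain[of t] by (auto simp: labelled_def)
    then show "t \<in> (\<Union>l\<in>{Suc j..m-1}. level l n)"
      using t assms by (intro UN_I[of l]) (auto simp: level_def v_less_iff)
  next
    fix t assume "t \<in> (\<Union>l\<in>{Suc j..m-1}. level l n)"
    then show "t \<in> {t \<in> labelled m n. v j < eval_form v t}"
      using assms by (auto simp: level_def v_less_iff)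
  qed
  also have "card \<dots> = (\<Sum>l=Suc j..m-1. card (level l n))"
  proof (rule card_UN_disjoint)
    show "\<forall>k\<in>{Suc j..m-1}. \<forall>l\<in>{Suc j..m-1}. k \<noteq> l \<longrightarrow> level k n \<inter> level l n = {}"
      using m by (auto simp: level_def inj_on_eq_iff[OF inj_v])
  qed (auto simp: finite_level)
  finally show ?thesis .
qed

lemma godel_imp_eq_iff:
  assumes "j < m - 1"
  shows "godel_imp a b = v j \<longleftrightarrow> v j < a \<and> b = v j"
proof -
  \<comment> \<open>This rules out the branch of \<open>godel_imp\<close> with value 1.\<close>
  have "v j < 1"
    using assms v_less_iff[of j "m - 1"] unfolding top by simp
  then show ?thesis by (auto simp: godel_imp_def)
qed

lemma card_level_rec:
  assumes j: "j < m - 1" and n: "n \<ge> 2"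
  shows "card (level j n) = (\<Sum>i=0..n. (\<Sum>l=Suc j..m-1. card (level l i)) * card (level j (n - i)))"
proof -
  let ?A = "\<lambda>i. {t \<in> labelled m i. v j < eval_form v t}"
  have inj: "inj_on (case_prod Imp) X" for X
    by (auto simp: inj_on_def)
  have "level j n = (\<Union>i\<in>{0..n}. case_prod Imp ` (?A i \<times> level j (n - i)))"
    unfolding level_def labelled_split[OF n] by (fastforce simp: godel_imp_eq_iff[OF j])
  also have "card \<dots> = (\<Sum>i=0..n. card (case_prod Imp ` (?A i \<times> level j (n - i))))"
  \<comment> \<open>The union is disjoint because \<open>i\<close> is the number of leaves of the
    left subformula.\<close>
  proof (rule card_UN_disjoint)
    show "\<forall>i\<in>{0..n}. finite (case_prod Imp ` (?A i \<times> level j (n - i)))"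
      by (simp add: finite_level finite_labelled)
  qed (auto simp: labelled_def)
  also have "\<dots> = (\<Sum>i=0..n. card (?A i) * card (level j (n - i)))"
    by (intro sum.cong refl) (simp add: card_image[OF inj] card_cartesian_product)
  finally show ?thesis using j by (simp add: card_above)
qed

section \<open>From counts to generating functions\<close>

lemma G_val_nth: "fps_nth (G_val m v j) n = of_nat (card (level j n))"
  by (cases "n = 0") (auto simp: G_val_def g_val_eq_card_level level_def labelled_0)

lemma G_val_rec:
  assumes j: "j < m - 1"
  shows "G_val m v j = fps_X + H_ser m v (Suc j) * G_val m v j"
proof (rule fps_ext)
  fix n :: nat
  have 0: "level l 0 = {}" for l by (simp add: level_def labelled_0)
  have "level j 1 = {Var j}"
    using j inj_v unfolding level_def labelled_1 by (auto simp: inj_on_eq_iff)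
  then have 1: "card (level j (Suc 0)) = 1" by simp
  \<comment> \<open>For \<open>n \<le> 1\<close> every term of the product has a factor counting
    formulas with zero leaves, so only \<open>fps_X\<close> contributes, matching the single formula
    \<open>Var j\<close>.\<close>
  consider "n = 0" | "n = 1" | "n \<ge> 2" by linarith
  then show "fps_nth (G_val m v j) n = fps_nth (fps_X + H_ser m v (Suc j) * G_val m v j) n"
    by cases (simp_all add: fps_mult_nth H_ser_def fps_sum_nth G_val_nth 0 1 card_level_rec[OF j])
qed

lemma H_ser_Phi:
  assumes "k < m - 1"
  shows "H_ser m v k = Phi (H_ser m v (k + 1))"
proof -
  let ?H = "H_ser m v (Suc k)"
  \<comment> \<open>The constant term is 1, so \<open>1 - ?H\<close> is nonzero and may be
    cancelled.\<close>
  have unit: "fps_nth (1 - ?H) 0 \<noteq> 0" by (simp add: H_ser_nth_0)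
  have "G_val m v k * (1 - ?H) = fps_X"
    using G_val_rec[OF assms] by (simp add: algebra_simps)
  then have "G_val m v k = fps_X / (1 - ?H)"
    using unit by (metis fps_nonzeroI nonzero_mult_div_cancel_right)
  moreover have "H_ser m v k = G_val m v k + ?H"
    using assms by (simp add: H_ser_def sum.atLeast_Suc_atMost)
  ultimately show ?thesis by (simp add: Phi_def)
qed

text \<open>Indexing by the distance \<open>i\<close> from the top makes each induction step apply
  one more outer \<open>Phi\<close>; \<open>i = m - 1\<close> reaches
  \<open>H_ser m v 0\<close>.\<close>

lemma H_ser_iterate: "i \<le> m - 1 \<Longrightarrow> H_ser m v (m - 1 - i) = (Phi ^^ i) (H_ser m v (m - 1))"
proof (induction i)
  case (Suc i)
  then have "Suc (m - 1 - Suc i) = m - 1 - i" by simp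
  then show ?case using Suc H_ser_Phi[of "m - 1 - Suc i"] by simp
qed simp

end

lemma G_total_eq_H_ser: "G_total m v = H_ser m v 0"
  by (rule fps_ext) (simp add: G_total_def H_ser_def G_val_def fps_sum_nth g_total_def)

theorem proposition5:
  fixes m :: nat and v :: "nat \<Rightarrow> 'a::{linorder,zero,one}"
  assumes "m \<ge> 2"
    and "strict_mono_on {..<m} v"
    and "v 0 = 0"
    and "v (m - 1) = 1"
  shows "(\<forall>k\<in>{0..m-2}. H_ser m v k = Phi (H_ser m v (k + 1)))
    \<and> H_ser m v (m - 1) = G_val m v (m - 1)
    \<and> G_total m v = (Phi ^^ (m - 1)) (H_ser m v (m - 1))"
proof -
  interpret godel_chain m v
    using assms by unfold_locales
  have "H_ser m v k = Phi (H_ser m v (k + 1))" if "k \<in> {0..m-2}" for k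
    using that assms(1) by (intro H_ser_Phi) auto
  moreover have "H_ser m v (m - 1) = G_val m v (m - 1)"
    by (simp add: H_ser_def)
  moreover have "G_total m v = (Phi ^^ (m - 1)) (H_ser m v (m - 1))"
    using H_ser_iterate[of "m - 1"] by (simp add: G_total_eq_H_ser)
  ultimately show ?thesis by blast
qed

end
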